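(* Let $\alpha$ and $\beta$ be irrational numbers. Then there exist continuous functions $f,g\in C(\mathbb T)$ such that $(I-T_\alpha)f=(I-T_\beta)g$, but there is no measurable function $h$ on $\mathbb T$ satisfying $(I-T_\alpha)(I-T_\beta)h=(I-T_\alpha)f$.
   Context: $\mathbb T$ is the unit circle in $\mathbb C$ with normalized Lebesgue measure, and for real $\alpha$ and a (measurable) function $f$ on $\mathbb T$, $T_\alpha f(z)=f(e^{2\pi i\alpha}z)$. Equalities involving measurable functions are understood almost everywhere; measurable functions are finite-valued a.e. and need not be integrable. *)

theory Defs
  imports "HOL-Analysis.Analysis"
begin

definition unit_circle :: "complex set" where
  "unit_circle = sphere 0 1"

text \<open>Normalized Lebesgue measure on the unit circle: the image of Lebesgue measure on
  \<open>[0,1)\<close> under \<open>t \<mapsto> exp (2\<pi>it)\<close>, completed so that the measurable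
  functions are the Lebesgue measurable ones and not only the Borel measurable ones.\<close>

definition circle_measure :: "complex measure" where
  "circle_measure = completion
     (distr (restrict_space lborel {0..<1::real}) (restrict_space borel unit_circle)
       (\<lambda>t. exp (2 * of_real pi * \<i> * of_real t)))"

definition rot :: "real \<Rightarrow> (complex \<Rightarrow> complex) \<Rightarrow> complex \<Rightarrow> complex" where
  "rot \<alpha> f = (\<lambda>z. f (exp (2 * of_real pi * \<i> * of_real \<alpha>) * z))"

definition id_minus_rot :: "real \<Rightarrow> (complex \<Rightarrow> complex) \<Rightarrow> complex \<Rightarrow> complex" where
  "id_minus_rot \<alpha> f = (\<lambda>z. f z - rot \<alpha> f z)"

end

theory Submission
  imports Defs
begin

text \<open>
  Formally the equation forces \<open>h = \<Sum>\<^sub>k z^(n\<^sub>k)\<close>; the frequencies \<open>n\<^sub>k\<close> are chosen so that this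
  series is hopelessly divergent while \<open>f = (I - T\<^sub>\<beta>)h\<close> and \<open>g = (I - T\<^sub>\<alpha>)h\<close> converge absolutely,
  which only needs \<open>n\<^sub>k\<alpha>\<close> and \<open>n\<^sub>k\<beta>\<close> to be very close to integers (Dirichlet).

  Suppose a measurable \<open>h\<close> exists.  Summing the equation over \<open>T\<^sub>\<alpha>^i T\<^sub>\<beta>^j\<close> with \<open>i < M\<close>, \<open>j < N\<close>
  telescopes to
  \<open>(I - T\<^sub>\<alpha>^M)(I - T\<^sub>\<beta>^N)h = \<Sum>\<^sub>k (1 - e(n\<^sub>kM\<alpha>))(1 - e(n\<^sub>kN\<beta>)) z^(n\<^sub>k)\<close> almost everywhere.
  For given \<open>j\<close>, density of the multiples of an irrational number yields \<open>M\<close>, \<open>N\<close> such that the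
  fractional parts of \<open>M\<alpha>\<close>, \<open>N\<beta>\<close> are about \<open>1/(2n\<^sub>j)\<close>.  Then the \<open>j\<close>-th term dominates: earlier
  frequencies are much smaller than \<open>n\<^sub>j\<close>, and later ones were chosen after \<open>M\<close>.  So the right side is
  bounded away from 0 everywhere.  But the left side is a second difference of \<open>h\<close> with arbitrarily
  small steps, which is small on a set of positive measure: \<open>h\<close> takes values in a small disc on some
  set \<open>A\<close> of positive measure, and \<open>A\<close> meets its small translates in positive measure.
\<close>

subsection \<open>The exponential parametrization of the circle\<close>

definition e2pi :: "real \<Rightarrow> complex" where
  "e2pi t = exp (2 * of_real pi * \<i> * of_real t)"

lemma e2pi_add: "e2pi (s + t) = e2pi s * e2pi t"
  by (simp add: e2pi_def exp_add distrib_left)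

lemma norm_e2pi [simp]: "norm (e2pi t) = 1"
  by (simp add: e2pi_def)

lemma e2pi_in_unit_circle [simp]: "e2pi t \<in> unit_circle"
  by (simp add: unit_circle_def)

lemma e2pi_of_int [simp]: "e2pi (of_int k) = 1"
proof -
  have "e2pi (of_int k) = exp (2 * of_int k * of_real pi * \<i>)"
    by (simp add: e2pi_def mult_ac)
  then show ?thesis
    using exp_integer_2pi[of "of_int k"] by (simp add: mult_ac)
qed

lemma e2pi_add_of_int [simp]: "e2pi (t + of_int k) = e2pi t"
  by (simp add: e2pi_add)

lemma e2pi_frac [simp]: "e2pi (frac t) = e2pi t"
  using e2pi_add_of_int[of "frac t" "\<lfloor>t\<rfloor>"] by (simp add: frac_def)

lemma e2pi_of_nat_mult: "e2pi (of_nat n * t) = e2pi t ^ n"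
  by (simp add: e2pi_def flip: exp_of_nat_mult) (simp add: mult_ac)

lemma continuous_on_e2pi: "continuous_on A e2pi"
  unfolding e2pi_def by (intro continuous_intros)

lemma rot_e2pi: "rot \<alpha> f (e2pi t) = f (e2pi (t + \<alpha>))"
  unfolding rot_def e2pi_add e2pi_def[of \<alpha>, symmetric] by (simp add: mult.commute)

lemma norm_one_minus_e2pi: "norm (1 - e2pi t) = 2 * \<bar>sin (pi * t)\<bar>"
  using dist_exp_i_1[of "2 * pi * t"] by (simp add: e2pi_def norm_minus_commute mult_ac)

lemma norm_one_minus_e2pi_le_2: "norm (1 - e2pi t) \<le> 2"
  by (simp add: norm_one_minus_e2pi)

lemma norm_one_minus_e2pi_le: "norm (1 - e2pi t) \<le> 7 * \<bar>t - of_int m\<bar>"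
proof -
  have "norm (1 - e2pi t) = norm (1 - e2pi (t - of_int m))"
    using e2pi_add_of_int[of t "-m"] by simp
  also have "\<dots> \<le> 2 * \<bar>pi * (t - of_int m)\<bar>"
    using abs_sin_x_le_abs_x by (simp add: norm_one_minus_e2pi)
  also have "\<dots> \<le> 7 * \<bar>t - of_int m\<bar>"
    \<comment> \<open>The constant 7 is a convenient upper bound for 2 pi.\<close>
    using mult_right_mono[of "2 * pi" 7 "\<bar>t - of_int m\<bar>"] pi_less_4 pi_approx
    by (simp add: abs_mult)
  finally show ?thesis .
qed

lemma norm_one_minus_e2pi_ge_1:
  assumes "1/4 \<le> t" "t \<le> 3/4"
  shows "1 \<le> norm (1 - e2pi t)"
proof -
  have "Re (e2pi t) = cos (2 * pi * t)"
    by (simp add: e2pi_def Re_exp mult_ac)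
  also have "\<dots> = - cos (2 * pi * t - pi)"
    by (simp add: cos_diff)
  also have "\<dots> \<le> 0"
  proof -
    have "pi * (1/2) \<le> pi * (2 * t)" "pi * (2 * t) \<le> pi * (3/2)"
      using assms by (intro mult_left_mono; simp)+
    then have "0 \<le> cos (2 * pi * t - pi)"
      by (intro cos_ge_zero; linarith)
    then show ?thesis by simp
  qed
  finally have "1 \<le> Re (1 - e2pi t)" by simp
  also have "\<dots> \<le> norm (1 - e2pi t)" by (rule complex_Re_le_cmod)
  finally show ?thesis .
qed

text \<open>Factor out the geometric sum of \<open>n\<close> unimodular terms. This turns
  near-invariance of a frequency under one rotation into near-invariance under \<open>n\<close>
  rotations.\<close>

lemma norm_one_minus_e2pi_of_nat_mult:
  "norm (1 - e2pi (of_nat n * t)) \<le> of_nat n * norm (1 - e2pi t)"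
proof -
  have "1 - e2pi t ^ n = (1 - e2pi t) * (\<Sum>i<n. e2pi t ^ i)"
    by (rule one_diff_power_eq)
  moreover have "norm (\<Sum>i<n. e2pi t ^ i) \<le> of_nat n"
    by (rule order_trans[OF norm_sum]) (simp add: norm_power)
  ultimately show ?thesis
    unfolding e2pi_of_nat_mult by (simp add: norm_mult mult.commute[of "of_nat n"] mult_left_mono)
qed

subsection \<open>Second differences\<close>

definition second_diff :: "(real \<Rightarrow> complex) \<Rightarrow> real \<Rightarrow> real \<Rightarrow> real \<Rightarrow> complex" where
  "second_diff u x y t = u t - u (t + x) - u (t + y) + u (t + x + y)"

text \<open>For a fixed step in the other direction, the sum over \<open>j\<close> telescopes; the
  sum over \<open>i\<close> then telescopes in the same way.\<close>

lemma sum_second_diff: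
  "(\<Sum>i<M. \<Sum>j<N. second_diff u x y (t + of_nat i * x + of_nat j * y))
   = second_diff u (of_nat M * x) (of_nat N * y) t"
proof -
  have *: "(\<Sum>j<N. second_diff u x y (s + of_nat j * y)) = second_diff u x (of_nat N * y) s" for s
    by (induction N) (simp_all add: second_diff_def algebra_simps)
  show ?thesis
    unfolding * by (induction M) (simp_all add: second_diff_def algebra_simps)
qed

lemma second_diff_e2pi:
  "second_diff (\<lambda>t. e2pi (c * t)) x y t = (1 - e2pi (c * x)) * (1 - e2pi (c * y)) * e2pi (c * t)"
  by (simp add: second_diff_def distrib_left e2pi_add algebra_simps)

text \<open>By periodicity, the long steps M\<alpha> and N\<beta> may be replaced by their
  fractional parts, which will be small.\<close>

lemma second_diff_comp_e2pi_frac: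
  "second_diff (\<lambda>t. h (e2pi t)) x y t = second_diff (\<lambda>t. h (e2pi t)) (frac x) (frac y) t"
  by (simp add: second_diff_def e2pi_add)

lemma id_minus_rot_id_minus_rot_e2pi:
  "id_minus_rot \<alpha> (id_minus_rot \<beta> h) (e2pi t) = second_diff (\<lambda>t. h (e2pi t)) \<alpha> \<beta> t"
proof -
  have "id_minus_rot c f (e2pi s) = f (e2pi s) - f (e2pi (s + c))" for c f s
    by (simp add: id_minus_rot_def rot_e2pi)
  then show ?thesis
    by (simp add: second_diff_def)
qed

subsection \<open>Choice of the frequencies\<close>

text \<open>Kronecker approximation with target 1/(2n) and tolerance 1/(4n). Such a tiny rotation
  still turns frequency \<open>n\<close> by between a quarter and three quarters of a full
  turn.\<close>

lemma ex_frac_multiple_between: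
  fixes \<theta> :: real and n :: nat
  assumes "\<theta> \<notin> \<rat>" "0 < n"
  shows "\<exists>k::nat. 1/4 \<le> n * frac (k * \<theta>) \<and> n * frac (k * \<theta>) \<le> 3/4"
proof -
  obtain k where "\<bar>frac (real k * \<theta>) - 1 / (2 * n)\<bar> < 1 / (4 * n)"
    using Kronecker_approx_1_explicit[OF assms(1), of "1 / (2 * n)" "1 / (4 * n)"] assms(2)
    by auto
  then have "n * \<bar>frac (real k * \<theta>) - 1 / (2 * n)\<bar> \<le> n * (1 / (4 * n))"
    by (intro mult_left_mono) auto
  then have "\<bar>n * (frac (real k * \<theta>) - 1 / (2 * n))\<bar> \<le> 1/4"
    using assms(2) by (simp add: abs_mult)
  then have "\<bar>n * frac (real k * \<theta>) - 1/2\<bar> \<le> 1/4"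
    using assms(2) by (simp add: right_diff_distrib)
  then show ?thesis
    by (intro exI[of _ k]) (simp only: abs_le_iff, linarith)
qed

text \<open>Simultaneous Dirichlet approximation gives a suitable \<open>q\<close> without control
  of its size. Multiplying \<open>q\<close> by L + 1 makes it large and costs a factor L + 1 in the
  error, which the choice of \<open>N\<close> absorbs.\<close>

lemma ex_large_simult_near_one:
  fixes \<alpha> \<beta> \<epsilon> :: real
  assumes "0 < \<epsilon>"
  obtains n where "L \<le> n" "0 < n" "norm (1 - e2pi (of_nat n * \<alpha>)) \<le> \<epsilon>" "norm (1 - e2pi (of_nat n * \<beta>)) \<le> \<epsilon>"
proof -
  obtain N :: nat where N: "7 * (real L + 1) / \<epsilon> < N" using reals_Archimedean2 by blast
  with assms have "0 < N"
    by (metis add_nonneg_nonneg divide_nonneg_nonneg gr0I less_eq_real_def mult_nonneg_nonneg not_le of_nat_0 of_nat_0_le_iff zero_le_numeral zero_le_one)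
  then obtain q p where q: "0 < q"
      and p: "\<And>i. i < 2 \<Longrightarrow> \<bar>of_int q * (case_nat \<alpha> (\<lambda>_. \<beta>) i) - of_int (p i)\<bar> < 1 / N"
    using Dirichlet_approx_simult[of N 2 "case_nat \<alpha> (\<lambda>_. \<beta>)"] by metis
  define n where "n = (L + 1) * nat q"
  have near: "norm (1 - e2pi (of_nat n * \<theta>)) \<le> \<epsilon>" if "\<bar>of_int q * \<theta> - of_int m\<bar> < 1 / N" for \<theta> m
  proof -
    have "real n * \<theta> - of_int (int (L + 1) * m) = (real L + 1) * (of_int q * \<theta> - of_int m)"
      using q by (simp add: n_def algebra_simps)
    then have "norm (1 - e2pi (of_nat n * \<theta>)) \<le> 7 * \<bar>(real L + 1) * (of_int q * \<theta> - of_int m)\<bar>"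
      using norm_one_minus_e2pi_le[of "real n * \<theta>" "int (L + 1) * m"] by simp
    also have "\<dots> = 7 * (real L + 1) * \<bar>of_int q * \<theta> - of_int m\<bar>"
      by (subst abs_mult) simp
    also have "\<dots> \<le> 7 * (real L + 1) * (1 / N)"
      using that by (intro mult_left_mono) auto
    also have "\<dots> \<le> \<epsilon>"
      using N assms \<open>0 < N\<close> by (simp add: field_simps)
    finally show ?thesis .
  qed
  show ?thesis
  proof (rule that[of n])
    show "L \<le> n" "0 < n"
      using q mult_le_mono[of L "L + 1" 1 "nat q"] by (auto simp: n_def)
    show "norm (1 - e2pi (of_nat n * \<alpha>)) \<le> \<epsilon>" "norm (1 - e2pi (of_nat n * \<beta>)) \<le> \<epsilon>"
      using near p[of 0] p[of 1] by auto
  qed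
qed

text \<open>\<open>K m\<close> is the number of rotations that makes frequency \<open>m\<close> visible, so every later frequency
  has to be nearly invariant under that many rotations as well.\<close>
lemma ex_sparse_frequencies:
  fixes \<alpha> \<beta> :: real and K :: "nat \<Rightarrow> nat"
  obtains n :: "nat \<Rightarrow> nat" where
    "\<And>k. 0 < n k"
    "\<And>k. 56 * (\<Sum>j<k. n j) \<le> n k"
    "\<And>k. 2 ^ k * 16 * norm (1 - e2pi (of_nat (n k) * \<alpha>)) \<le> 1"
    "\<And>k. 2 ^ k * 16 * norm (1 - e2pi (of_nat (n k) * \<beta>)) \<le> 1"
    "\<And>j k. j < k \<Longrightarrow> 2 ^ k * 16 * of_nat (K (n j)) * norm (1 - e2pi (of_nat (n k) * \<alpha>)) \<le> 1"
proof -
  \<comment> \<open>One tolerance serves all the bounds: the summand 1 yields those without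
    \<open>K\<close>, and the sum over earlier frequencies dominates each single
    \<open>K (n j)\<close>.\<close>
  define P where "P f k m \<longleftrightarrow> 0 < m \<and> 56 * (\<Sum>j<k. f j) \<le> m \<and>
    norm (1 - e2pi (of_nat m * \<alpha>)) \<le> 1 / (2 ^ k * 16 * (1 + of_nat (\<Sum>j<k. K (f j)))) \<and>
    norm (1 - e2pi (of_nat m * \<beta>)) \<le> 1 / (2 ^ k * 16 * (1 + of_nat (\<Sum>j<k. K (f j))))"
    for f :: "nat \<Rightarrow> nat" and k m :: nat
  have "\<exists>n. \<forall>k. P n k (n k)"
  proof (rule dependent_wellorder_choice)
    show "P f k m = P g k m" if "\<And>j. j < k \<Longrightarrow> f j = g j" for m f g k
    proof -
      have "(\<Sum>j<k. f j) = (\<Sum>j<k. g j)" "(\<Sum>j<k. K (f j)) = (\<Sum>j<k. K (g j))"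
        using that by auto
      then show ?thesis by (simp only: P_def)
    qed
    show "\<exists>m. P f k m" for k f
    proof -
      have "0 < 1 / (2 ^ k * 16 * (1 + real (\<Sum>j<k. K (f j))))" by (simp add: add_pos_nonneg sum_nonneg)
      from ex_large_simult_near_one[OF this] show ?thesis unfolding P_def by metis
    qed
  qed
  then obtain n where n: "P n k (n k)" for k by blast
  have bnd: "2 ^ k * 16 * c * x \<le> 1"
    if "x \<le> 1 / (2 ^ k * 16 * (1 + of_nat (\<Sum>j<k. K (n j))))" "0 \<le> c" "c \<le> 1 + of_nat (\<Sum>j<k. K (n j))" "0 \<le> x"
    for k and c x :: real
  proof -
    have "2 ^ k * 16 * c * x \<le> 2 ^ k * 16 * (1 + of_nat (\<Sum>j<k. K (n j))) * x"
      using that by (intro mult_right_mono mult_left_mono) auto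
    also have "\<dots> \<le> 1"
      using that(1) by (simp add: field_simps add_pos_nonneg del: of_nat_sum)
    finally show ?thesis .
  qed
  show ?thesis
  proof (rule that)
    fix k
    show "0 < n k" "56 * (\<Sum>j<k. n j) \<le> n k"
      using n[of k] by (auto simp: P_def)
    show "2 ^ k * 16 * norm (1 - e2pi (of_nat (n k) * \<alpha>)) \<le> 1"
      using n[of k] bnd[of "norm (1 - e2pi (of_nat (n k) * \<alpha>))" k 1] by (auto simp: P_def sum_nonneg)
    show "2 ^ k * 16 * norm (1 - e2pi (of_nat (n k) * \<beta>)) \<le> 1"
      using n[of k] bnd[of "norm (1 - e2pi (of_nat (n k) * \<beta>))" k 1] by (auto simp: P_def sum_nonneg)
  next
    fix j k :: nat
    assume "j < k"
    then have "K (n j) \<le> (\<Sum>j<k. K (n j))"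
      by (intro member_le_sum) auto
    then have "real (K (n j)) \<le> 1 + of_nat (\<Sum>j<k. K (n j))"
      by (simp del: of_nat_sum)
    then show "2 ^ k * 16 * of_nat (K (n j)) * norm (1 - e2pi (of_nat (n k) * \<alpha>)) \<le> 1"
      using n[of k] by (intro bnd) (auto simp: P_def)
  qed
qed

subsection \<open>Domination by a single term\<close>

text \<open>Zeroing the \<open>j\<close>-th term leaves a series dominated by \<open>c\<close>; the
  triangle inequality does the rest.\<close>

lemma norm_suminf_ge_dominant_term:
  fixes x :: "nat \<Rightarrow> 'a::banach"
  assumes "summable x" "\<And>k. k \<noteq> j \<Longrightarrow> norm (x k) \<le> c k" "\<And>k. 0 \<le> c k" "summable c"
  shows "norm (x j) - suminf c \<le> norm (suminf x)"
proof -
  define y where "y k = (if k = j then 0 else x k)" for k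
  have yc: "norm (y k) \<le> c k" for k
    using assms(2,3) by (simp add: y_def)
  have y: "summable y"
    using summable_comparison_test'[OF assms(4), of 0 y] yc by blast
  have "x = (\<lambda>k. y k + (if k = j then x k else 0))"
    by (auto simp: y_def)
  moreover have "(\<lambda>k. y k + (if k = j then x k else 0)) sums (suminf y + x j)"
    by (intro sums_add summable_sums y sums_single)
  ultimately have "suminf x = suminf y + x j"
    by (simp add: sums_iff)
  moreover have "norm (suminf y) \<le> suminf c"
    using norm_suminf_le[OF _ assms(4), of y] yc by blast
  ultimately show ?thesis
    using norm_triangle_ineq4[of "suminf x" "suminf y"] by simp
qed

lemma e2pi_of_nat_mult_frac: "e2pi (of_nat n * frac x) = e2pi (of_nat n * x)"
  by (simp add: e2pi_of_nat_mult)

text \<open>The \<open>j\<close>-th term has norm at least 1, while the majorants of all other terms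
  sum to at most 1/4 + 1/4.\<close>

lemma lacunary_second_diff_ge:
  fixes n :: "nat \<Rightarrow> nat" and x y t :: real
  assumes pos: "0 < n j" and growth: "56 * (\<Sum>k<j. n k) \<le> n j"
    and x: "1/4 \<le> n j * frac x" "n j * frac x \<le> 3/4"
    and y: "1/4 \<le> n j * frac y" "n j * frac y \<le> 3/4"
    and far: "\<And>k. j < k \<Longrightarrow> norm (1 - e2pi (n k * x)) \<le> (1/2) ^ k / 16"
  shows "1/2 \<le> norm (\<Sum>k. second_diff (\<lambda>t. e2pi (n k * t)) x y t)"
proof -
  define X where "X k = second_diff (\<lambda>t. e2pi (n k * t)) x y t" for k
  \<comment> \<open>For earlier terms, 14 = 7 * 2: the linear bound on the x-factor, with
    \<open>frac x\<close> at most \<open>1 / n j\<close>, times the trivial bound 2 on the y-factor.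
    The growth constant 56 = 4 * 14 makes these sum to at most 1/4. The geometric part is the bound
    \<open>far\<close> times 2, kept at every index for an easy sum 1/4.\<close>
  define c where "c k = (if k \<in> {..<j} then 14 * n k / n j else 0) + (1/2) ^ k / 8" for k
  have norm_X: "norm (X k) = norm (1 - e2pi (n k * x)) * norm (1 - e2pi (n k * y))" for k
    by (simp add: X_def second_diff_e2pi norm_mult)
  have c_nonneg: "0 \<le> c k" for k
    by (simp add: c_def)
  have geom: "(\<lambda>k. (1/2) ^ k / 8) sums (2 / 8 :: real)"
    using sums_divide[OF geometric_sums[of "1/2 :: real"], of 8] by simp
  have c_sums: "c sums ((\<Sum>k<j. 14 * n k / n j) + 2 / 8)"
    unfolding c_def by (intro sums_add sums_If_finite_set geom) simp
  have "(\<Sum>k<j. 14 * n k / n j) = 14 * real (\<Sum>k<j. n k) / n j"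
    by (simp add: sum_distrib_left sum_divide_distrib)
  also have "\<dots> \<le> 1 / 4"
  proof -
    have "56 * real (\<Sum>k<j. n k) \<le> n j"
      using growth by (metis of_nat_le_iff of_nat_mult of_nat_numeral)
    then show ?thesis using pos by (simp add: field_simps)
  qed
  finally have c_le: "suminf c \<le> 1/2"
    using c_sums by (simp add: sums_iff)
  have X_le: "norm (X k) \<le> c k" if "k \<noteq> j" for k
  proof (cases "k < j")
    case True
    have "norm (1 - e2pi (n k * x)) \<le> 7 * (n k * frac x)"
      using norm_one_minus_e2pi_le[of "n k * frac x" 0] by (simp add: e2pi_of_nat_mult_frac)
    also have "\<dots> \<le> 7 * (n k * (1 / n j))"
      using x(2) pos by (intro mult_left_mono) (auto simp: field_simps)
    finally have "norm (X k) \<le> 7 * (n k * (1 / n j)) * 2"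
      unfolding norm_X by (intro mult_mono norm_one_minus_e2pi_le_2) auto
    then show ?thesis
      using True by (simp add: c_def add_increasing2)
  next
    case False
    have "norm (X k) \<le> (1/2) ^ k / 16 * 2"
      unfolding norm_X using False that by (intro mult_mono norm_one_minus_e2pi_le_2 far) auto
    then show ?thesis
      using False by (simp add: c_def)
  qed
  \<comment> \<open>The comparison starts at \<open>Suc j\<close>, since \<open>c\<close> need not
    dominate the \<open>j\<close>-th term.\<close>
  have "summable X"
    using X_le by (intro summable_comparison_test'[OF sums_summable[OF c_sums], of "Suc j"]) auto
  then have "norm (X j) - suminf c \<le> norm (suminf X)"
    by (rule norm_suminf_ge_dominant_term[OF _ X_le c_nonneg sums_summable[OF c_sums]])
  moreover have "1 * 1 \<le> norm (X j)"
    unfolding norm_X using norm_one_minus_e2pi_ge_1[OF x] norm_one_minus_e2pi_ge_1[OF y]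
    by (intro mult_mono) (auto simp: e2pi_of_nat_mult_frac)
  ultimately show ?thesis
    using c_le by (simp add: X_def[abs_def])
qed

subsection \<open>Measurable functions and small translations\<close>

text \<open>A Steinhaus argument: take a compact \<open>T\<close> inside \<open>A\<close> of
  positive measure and an open \<open>U\<close> around \<open>T\<close> with excess less than |T|/8.
  Small translates of \<open>T\<close> stay in \<open>U\<close>, so each of the four vertex
  conditions fails only on a part of \<open>U\<close> of measure less than |T|/8. The four parts
  together cannot exhaust \<open>U\<close>.\<close>

lemma positive_measure_parallelogram:
  fixes A :: "real set"
  assumes A: "A \<in> sets lborel" "A \<subseteq> {a..b}" "emeasure lborel A \<noteq> 0"
  obtains \<delta> where "0 < \<delta>"
    "\<And>x y. \<lbrakk>\<bar>x\<bar> < \<delta>; \<bar>y\<bar> < \<delta>\<rbrakk> \<Longrightarrow>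
       \<not> negligible {t. t \<in> A \<and> t + x \<in> A \<and> t + y \<in> A \<and> t + x + y \<in> A}"
proof -
  have Al: "A \<in> lmeasurable"
    using A bounded_subset[OF bounded_closed_interval A(2)] by (intro bounded_set_imp_lmeasurable) auto
  have "0 < measure lebesgue A"
    using A(1,3) emeasure_eq_measure2[OF Al] by (auto simp: zero_less_measure_iff)
  then obtain T where T: "closed T" "T \<subseteq> A" "A - T \<in> lmeasurable" "emeasure lebesgue (A - T) < measure lebesgue A"
    using sets_lebesgue_inner_closed[of A "measure lebesgue A"] Al by (auto simp: fmeasurableD)
  have cT: "compact T"
    using T(1,2) A(2) by (meson bounded_closed_interval bounded_subset compact_eq_bounded_closed)
  then have Tl: "T \<in> lmeasurable"
    by (rule lmeasurable_compact)
  have "measure lebesgue (A - T) < measure lebesgue A"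
    using T(3,4) by (simp add: emeasure_eq_measure2 ennreal_less_iff)
  then have mT: "0 < measure lebesgue T"
    using measurable_measure_Diff[OF Al _ T(2)] Tl by (simp add: fmeasurableD)
  then obtain U where U: "open U" "T \<subseteq> U" "U - T \<in> lmeasurable" "emeasure lebesgue (U - T) < measure lebesgue T / 8"
    using sets_lebesgue_outer_open[of T "measure lebesgue T / 8"] Tl by (auto simp: fmeasurableD)
  have mUT: "measure lebesgue (U - T) < measure lebesgue T / 8"
    using U(3,4) by (simp add: emeasure_eq_measure2 ennreal_less_iff)
  have Ul: "U \<in> lmeasurable"
    using fmeasurable.Un[OF U(3) Tl] U(2) by (simp add: Un_absorb2)
  have mU: "measure lebesgue U = measure lebesgue T + measure lebesgue (U - T)"
    using measurable_measure_Diff[OF Ul _ U(2)] Tl by (simp add: fmeasurableD)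
  obtain \<epsilon> where \<epsilon>: "0 < \<epsilon>" "(\<Union>x\<in>T. ball x \<epsilon>) \<subseteq> U"
    using compact_subset_open_imp_ball_epsilon_subset[OF cT U(1,2)] by blast
  define Ts where "Ts s = (+) (- s) ` T" for s
  have Ts_iff: "t \<in> Ts s \<longleftrightarrow> t + s \<in> T" for t s
    unfolding Ts_def image_iff by (auto intro: bexI[of _ "t + s"])
  have Tsl: "Ts s \<in> lmeasurable" "measure lebesgue (Ts s) = measure lebesgue T" for s
    unfolding Ts_def by (rule measurable_translation[OF Tl], rule measure_translation)
  have small: "measure lebesgue (U - Ts s) < measure lebesgue T / 8" if "\<bar>s\<bar> < \<epsilon>" for s
  proof -
    have "Ts s \<subseteq> U"
    proof
      fix t assume "t \<in> Ts s"
      then have "t + s \<in> T" "t \<in> ball (t + s) \<epsilon>"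
        using that by (auto simp: Ts_iff dist_real_def)
      then show "t \<in> U" using \<epsilon>(2) by blast
    qed
    then show ?thesis
      using measurable_measure_Diff[OF Ul _ \<open>Ts s \<subseteq> U\<close>] Tsl mU mUT by (simp add: fmeasurableD)
  qed
  show ?thesis
  \<comment> \<open>Half of \<epsilon>, so that x + y is still an admissible shift.\<close>
  proof (rule that[of "\<epsilon> / 2"])
    show "0 < \<epsilon> / 2" using \<epsilon> by simp
    fix x y assume xy: "\<bar>x\<bar> < \<epsilon> / 2" "\<bar>y\<bar> < \<epsilon> / 2"
    let ?B = "{t. t \<in> A \<and> t + x \<in> A \<and> t + y \<in> A \<and> t + x + y \<in> A}"
    show "\<not> negligible ?B"
    proof
      assume "negligible ?B"
      then have B: "?B \<in> lmeasurable" "measure lebesgue ?B = 0"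
        by (simp_all add: negligible_imp_measurable negligible_imp_measure0)
      let ?D = "\<lambda>s. U - Ts s"
      have D: "?D s \<in> lmeasurable" for s
        using Ul Tsl by (simp add: fmeasurable.Diff fmeasurableD)
      have sub: "U \<subseteq> ?B \<union> (?D 0 \<union> (?D x \<union> (?D y \<union> ?D (x + y))))"
        using T(2) by (auto simp: Ts_iff add.assoc)
      have "measure lebesgue U \<le> measure lebesgue (?B \<union> (?D 0 \<union> (?D x \<union> (?D y \<union> ?D (x + y)))))"
        by (intro measure_mono_fmeasurable sub fmeasurable.Un B D) (use Ul in \<open>auto simp: fmeasurableD\<close>)
      also have "\<dots> \<le> measure lebesgue ?B + (measure lebesgue (?D 0) + (measure lebesgue (?D x)
          + (measure lebesgue (?D y) + measure lebesgue (?D (x + y)))))"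
        by (intro order_trans[OF measure_Un_le] add_left_mono order_refl fmeasurableD fmeasurable.Un B D)
      also have "\<dots> < measure lebesgue T"
      proof -
        have "\<bar>0\<bar> < \<epsilon>" "\<bar>x\<bar> < \<epsilon>" "\<bar>y\<bar> < \<epsilon>" "\<bar>x + y\<bar> < \<epsilon>"
          using xy by linarith+
        from this[THEN small] show ?thesis using B(2) mT by linarith
      qed
      finally show False
        using mU measure_nonneg[of lebesgue "U - T"] by linarith
    qed
  qed
qed

section \<open>Transfer between the circle and the real line\<close>

lemma e2pi_measurable:
  "e2pi \<in> measurable (restrict_space lborel {0..<1}) (restrict_space borel unit_circle)"
  by (intro measurable_restrict_space2 measurable_restrict_space1)
     (auto simp: borel_measurable_continuous_onI continuous_on_e2pi)

lemma circle_measure_eq: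
  "circle_measure = completion
     (distr (restrict_space lborel {0..<1}) (restrict_space borel unit_circle) e2pi)"
  by (simp add: circle_measure_def e2pi_def[abs_def])

text \<open>The exceptional set is null in [0,1), and by periodicity its integer translates cover
  the exceptional set on the whole line. Working on the line allows free translation later.\<close>

lemma AE_circle_measureD:
  assumes "AE z in circle_measure. P z"
  shows "negligible {t. \<not> P (e2pi t)}"
proof -
  have "AE t in restrict_space lborel {0..<1}. P (e2pi t)"
    using assms e2pi_measurable unfolding circle_measure_eq AE_completion_iff by (auto dest: AE_distrD)
  then have "AE t in lborel. t \<in> {0..<1} \<longrightarrow> P (e2pi t)"
    by (subst (asm) AE_restrict_space_iff) auto
  then have "AE t in lebesgue. t \<in> {0..<1} \<longrightarrow> P (e2pi t)"
    by (rule AE_completion)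
  then have neg: "negligible {t\<in>{0..<1}. \<not> P (e2pi t)}" (is "negligible ?N")
    by (auto simp: negligible_iff_null_sets AE_iff_null_sets eventually_ae_filter intro: null_sets_completion_subset)
  have "{t. \<not> P (e2pi t)} \<subseteq> (\<Union>k. (+) (of_int k) ` ?N)"
  proof
    fix t assume "t \<in> {t. \<not> P (e2pi t)}"
    then have "frac t \<in> ?N" by (simp add: frac_lt_1)
    moreover have "t = of_int \<lfloor>t\<rfloor> + frac t" by (simp add: frac_def)
    ultimately show "t \<in> (\<Union>k. (+) (of_int k) ` ?N)" by blast
  qed
  moreover have "negligible (\<Union>k::int. (+) (of_int k) ` ?N)"
    by (intro negligible_countable_Union) (use negligible_translation[OF neg] in auto)
  ultimately show ?thesis by (rule negligible_subset[rotated])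
qed

text \<open>Countably many balls of radius \<open>r\<close> with centres in a dense set cover the
  range of \<open>h\<close>. Since the circle has measure 1, the preimage of one of them is not
  null.\<close>

lemma circle_measure_almost_constant_part:
  fixes h :: "complex \<Rightarrow> 'a::{second_countable_topology, metric_space}"
  assumes h: "h \<in> borel_measurable circle_measure" and "0 < r"
  obtains w A where "A \<in> sets lborel" "A \<subseteq> {0..<1::real}" "emeasure lborel A \<noteq> 0"
    "\<And>t. t \<in> A \<Longrightarrow> dist w (h (e2pi t)) < r"
proof -
  let ?M = "distr (restrict_space lborel {0..<1}) (restrict_space borel unit_circle) e2pi"
  obtain D :: "'a set" where D: "countable D" "\<And>X. open X \<Longrightarrow> X \<noteq> {} \<Longrightarrow> \<exists>d\<in>D. d \<in> X"
    by (rule countable_dense_setE) blast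
  define S where "S w = h -` ball w r \<inter> space circle_measure" for w
  have S: "S w \<in> sets circle_measure" for w
    unfolding S_def using h by (rule measurable_sets) simp
  have "space circle_measure \<subseteq> (\<Union>w\<in>D. S w)"
  proof
    fix z assume "z \<in> space circle_measure"
    moreover obtain w where "w \<in> D" "w \<in> ball (h z) r"
      using D(2)[of "ball (h z) r"] \<open>0 < r\<close> by auto
    ultimately show "z \<in> (\<Union>w\<in>D. S w)"
      by (auto simp: S_def dist_commute)
  qed
  then have "(\<Union>w\<in>D. S w) = space circle_measure"
    by (auto simp: S_def)
  moreover have "emeasure circle_measure (space circle_measure) = 1"
  proof -
    have *: "unit_circle \<in> sets (restrict_space borel unit_circle)"
      using sets.top[of "restrict_space borel unit_circle"] by (simp add: space_restrict_space)
    have "e2pi -` unit_circle \<inter> {0..<1} = {0..<1}" by auto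
    then have "emeasure ?M unit_circle = 1"
      using emeasure_distr[OF e2pi_measurable *]
      by (simp add: emeasure_restrict_space space_restrict_space)
    then show ?thesis
      using * by (simp add: circle_measure_eq space_restrict_space emeasure_completion)
  qed
  ultimately have "(\<Union>w\<in>D. S w) \<notin> null_sets circle_measure"
    by auto
  then obtain w where "S w \<notin> null_sets circle_measure"
    using null_sets_UN'[OF D(1)] by blast
  then have pos: "emeasure circle_measure (S w) \<noteq> 0"
    using S by auto
  \<comment> \<open>\<open>S w\<close> is measurable only for the completion. Its main part is a
    subset of equal measure in the original sigma-algebra, so its pullback under \<open>e2pi\<close>
    is Borel.\<close>
  define S' where "S' = main_part ?M (S w)"
  have S': "S' \<in> sets ?M" "S' \<subseteq> S w" "emeasure ?M S' \<noteq> 0"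
    using S[of w] pos main_part_sets[of "S w" ?M] main_part_null_part_Un[of "S w" ?M]
    by (auto simp: S'_def circle_measure_eq simp del: main_part_null_part_Un)
  define A where "A = e2pi -` S' \<inter> {0..<1}"
  have A: "A \<in> sets (restrict_space lborel {0..<1})"
    using measurable_sets[OF e2pi_measurable, of S'] S'(1) by (simp add: A_def space_restrict_space)
  show ?thesis
  proof (rule that[of A w])
    show "A \<in> sets lborel" using A by (subst (asm) sets_restrict_space_iff) auto
    show "A \<subseteq> {0..<1}" by (auto simp: A_def)
    show "emeasure lborel A \<noteq> 0"
      using S'(1,3) emeasure_distr[OF e2pi_measurable, of S']
      by (simp add: A_def emeasure_restrict_space space_restrict_space)
    show "dist w (h (e2pi t)) < r" if "t \<in> A" for t
      using that S'(2) by (auto simp: A_def S_def)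
  qed
qed

subsection \<open>Lacunary series on the circle\<close>

lemma summable_lacunary_series:
  fixes c :: "nat \<Rightarrow> complex" and n :: "nat \<Rightarrow> nat"
  assumes "summable (\<lambda>k. norm (c k))" "z \<in> unit_circle"
  shows "summable (\<lambda>k. c k * z ^ n k)"
  using assms by (intro summable_norm_cancel[of "\<lambda>k. c k * z ^ n k"])
    (simp add: norm_mult norm_power unit_circle_def)

lemma continuous_on_lacunary_series:
  fixes c :: "nat \<Rightarrow> complex" and n :: "nat \<Rightarrow> nat"
  assumes "summable (\<lambda>k. norm (c k))"
  shows "continuous_on unit_circle (\<lambda>z. \<Sum>k. c k * z ^ n k)"
proof (rule uniform_limit_theorem)
  show "uniform_limit unit_circle (\<lambda>N z. \<Sum>k<N. c k * z ^ n k) (\<lambda>z. \<Sum>k. c k * z ^ n k) sequentially"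
    using assms by (intro Weierstrass_m_test) (auto simp: norm_mult norm_power unit_circle_def)
qed (auto intro!: always_eventually continuous_intros)

lemma id_minus_rot_lacunary_series:
  fixes c :: "nat \<Rightarrow> complex" and n :: "nat \<Rightarrow> nat" and \<theta> :: real
  assumes c: "summable (\<lambda>k. norm (c k))" and z: "z \<in> unit_circle"
  shows "id_minus_rot \<theta> (\<lambda>z. \<Sum>k. c k * z ^ n k) z
    = (\<Sum>k. (1 - e2pi (n k * \<theta>)) * c k * z ^ n k)"
proof -
  have z': "e2pi \<theta> * z \<in> unit_circle"
    using z by (simp add: unit_circle_def norm_mult)
  have "id_minus_rot \<theta> (\<lambda>z. \<Sum>k. c k * z ^ n k) z
      = (\<Sum>k. c k * z ^ n k) - (\<Sum>k. c k * (e2pi \<theta> * z) ^ n k)"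
    by (simp add: id_minus_rot_def rot_def e2pi_def)
  also have "\<dots> = (\<Sum>k. c k * z ^ n k - c k * (e2pi \<theta> * z) ^ n k)"
    by (rule suminf_diff[OF summable_lacunary_series[OF c z] summable_lacunary_series[OF c z']])
  also have "\<dots> = (\<Sum>k. (1 - e2pi (n k * \<theta>)) * c k * z ^ n k)"
    unfolding e2pi_of_nat_mult by (intro suminf_cong) (simp add: power_mult_distrib algebra_simps)
  finally show ?thesis .
qed

text \<open>Only countably many shifts occur, so a single null set \<open>E\<close> works for all
  \<open>M\<close> and \<open>N\<close> at once. Off \<open>E\<close> the equation holds at every
  grid point and can be summed by telescoping.\<close>

lemma second_diff_series_off_negligible:
  fixes n :: "nat \<Rightarrow> nat" and \<alpha> \<beta> :: real
  defines "u \<equiv> \<lambda>k (t::real). e2pi (n k * t)"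
  assumes a: "summable (\<lambda>k. norm (1 - e2pi (n k * \<alpha>)))"
    and b: "summable (\<lambda>k. norm (1 - e2pi (n k * \<beta>)))"
    and h: "AE z in circle_measure. id_minus_rot \<alpha> (id_minus_rot \<beta> h) z
      = id_minus_rot \<alpha> (\<lambda>z. \<Sum>k. (1 - e2pi (n k * \<beta>)) * z ^ n k) z"
  obtains E where "negligible E"
    "\<And>M N t. t \<notin> E \<Longrightarrow> second_diff (\<lambda>t. h (e2pi t)) (of_nat M * \<alpha>) (of_nat N * \<beta>) t
      = (\<Sum>k. second_diff (u k) (of_nat M * \<alpha>) (of_nat N * \<beta>) t)"
proof -
  let ?H = "\<lambda>t. h (e2pi t)"
  define E0 where "E0 = {t. id_minus_rot \<alpha> (id_minus_rot \<beta> h) (e2pi t)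
    \<noteq> id_minus_rot \<alpha> (\<lambda>z. \<Sum>k. (1 - e2pi (n k * \<beta>)) * z ^ n k) (e2pi t)}"
  have neg: "negligible E0"
    using AE_circle_measureD[OF h] by (simp add: E0_def)
  define E where "E = (\<Union>i j. (+) (- (of_nat i * \<alpha> + of_nat j * \<beta>)) ` E0)"
  have "negligible E"
    unfolding E_def
    by (intro negligible_countable_Union) (use negligible_translation[OF neg] in auto)
  have u: "second_diff (u k) \<alpha> \<beta> t = (1 - e2pi (n k * \<alpha>)) * (1 - e2pi (n k * \<beta>)) * e2pi t ^ n k" for k t
    unfolding u_def second_diff_e2pi by (simp add: e2pi_of_nat_mult)
  have summable_ab: "summable (\<lambda>k. norm ((1 - e2pi (n k * \<alpha>)) * (1 - e2pi (n k * \<beta>))))"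
    by (rule summable_comparison_test'[OF summable_mult2[OF a, of 2], of 0])
       (auto simp: norm_mult intro!: mult_left_mono norm_one_minus_e2pi_le_2)
  have summable_u: "summable (\<lambda>k. second_diff (u k) \<alpha> \<beta> t)" for t
    unfolding u by (rule summable_lacunary_series[OF summable_ab]) simp
  have step: "second_diff ?H \<alpha> \<beta> t = (\<Sum>k. second_diff (u k) \<alpha> \<beta> t)" if "t \<notin> E0" for t
    using that
    by (simp add: E0_def u id_minus_rot_lacunary_series[OF b] flip: id_minus_rot_id_minus_rot_e2pi)
  have "second_diff ?H (of_nat M * \<alpha>) (of_nat N * \<beta>) t
      = (\<Sum>k. second_diff (u k) (of_nat M * \<alpha>) (of_nat N * \<beta>) t)" if t: "t \<notin> E" for M N t
  proof -
    have "t + of_nat i * \<alpha> + of_nat j * \<beta> \<notin> E0" for i j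
    proof
      assume "t + of_nat i * \<alpha> + of_nat j * \<beta> \<in> E0"
      then have "- (of_nat i * \<alpha> + of_nat j * \<beta>) + (t + of_nat i * \<alpha> + of_nat j * \<beta>) \<in> E"
        unfolding E_def by blast
      with t show False by simp
    qed
    then have "second_diff ?H (of_nat M * \<alpha>) (of_nat N * \<beta>) t
        = (\<Sum>i<M. \<Sum>j<N. \<Sum>k. second_diff (u k) \<alpha> \<beta> (t + of_nat i * \<alpha> + of_nat j * \<beta>))"
      by (simp add: step flip: sum_second_diff)
    also have "\<dots> = (\<Sum>k. \<Sum>i<M. \<Sum>j<N. second_diff (u k) \<alpha> \<beta> (t + of_nat i * \<alpha> + of_nat j * \<beta>))"
      by (simp add: suminf_sum summable_u summable_sum)
    finally show ?thesis by (simp add: sum_second_diff)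
  qed
  with \<open>negligible E\<close> show ?thesis by (rule that)
qed

section \<open>The continuous pair and the contradiction with a measurable solution\<close>

theorem corollary4p6:
  fixes \<alpha> \<beta> :: real
  assumes "\<alpha> \<notin> \<rat>" and "\<beta> \<notin> \<rat>"
  shows "\<exists>f g :: complex \<Rightarrow> complex.
    continuous_on unit_circle f \<and> continuous_on unit_circle g \<and>
    (\<forall>z\<in>unit_circle. id_minus_rot \<alpha> f z = id_minus_rot \<beta> g z) \<and>
    \<not> (\<exists>h :: complex \<Rightarrow> complex. h \<in> borel_measurable circle_measure \<and>
        (AE z in circle_measure.
          id_minus_rot \<alpha> (id_minus_rot \<beta> h) z = id_minus_rot \<alpha> f z))"
proof -
  \<comment> \<open>\<open>K\<close> and \<open>L\<close> are functions of the frequency alone and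
    are fixed before any frequency is chosen. Later terms will be controlled through their
    \<alpha>-factor, so the frequencies are adapted to \<open>K\<close>.\<close>
  obtain K :: "nat \<Rightarrow> nat"
    where K: "\<And>n::nat. 0 < n \<Longrightarrow> 1/4 \<le> n * frac (K n * \<alpha>) \<and> n * frac (K n * \<alpha>) \<le> 3/4"
    using ex_frac_multiple_between[OF assms(1)] by metis
  obtain L :: "nat \<Rightarrow> nat"
    where L: "\<And>n::nat. 0 < n \<Longrightarrow> 1/4 \<le> n * frac (L n * \<beta>) \<and> n * frac (L n * \<beta>) \<le> 3/4"
    using ex_frac_multiple_between[OF assms(2)] by metis
  obtain n where n_pos: "\<And>k. 0 < n k"
    and growth: "\<And>k. 56 * (\<Sum>j<k. n j) \<le> n k"
    and n\<alpha>: "\<And>k. 2 ^ k * 16 * norm (1 - e2pi (n k * \<alpha>)) \<le> 1"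
    and n\<beta>: "\<And>k. 2 ^ k * 16 * norm (1 - e2pi (n k * \<beta>)) \<le> 1"
    and nK: "\<And>j k. j < k \<Longrightarrow> 2 ^ k * 16 * real (K (n j)) * norm (1 - e2pi (n k * \<alpha>)) \<le> 1"
    by (rule ex_sparse_frequencies[where K = K and \<alpha> = \<alpha> and \<beta> = \<beta>]) blast
  define a where "a k = 1 - e2pi (n k * \<alpha>)" for k
  define b where "b k = 1 - e2pi (n k * \<beta>)" for k
  define f where "f z = (\<Sum>k. b k * z ^ n k)" for z
  define g where "g z = (\<Sum>k. a k * z ^ n k)" for z
  have summableI: "summable (\<lambda>k. norm (c k))" if "\<And>k. 2 ^ k * 16 * norm (c k) \<le> 1" for c :: "nat \<Rightarrow> complex"
  proof (rule summable_comparison_test'[of "\<lambda>k. (1/2) ^ k" 0])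
    show "norm (norm (c k)) \<le> (1/2) ^ k" for k
    proof -
      have "2 ^ k * norm (c k) \<le> 1" using that[of k] by simp
      then show ?thesis by (simp add: power_one_over field_simps)
    qed
  qed (simp add: summable_geometric)
  have a: "summable (\<lambda>k. norm (a k))" and b: "summable (\<lambda>k. norm (b k))"
    using n\<alpha> n\<beta> unfolding a_def b_def by (auto intro: summableI)
  \<comment> \<open>Both sides are the series with coefficients \<open>a k * b k\<close>.\<close>
  have f_g: "id_minus_rot \<alpha> f z = id_minus_rot \<beta> g z" if "z \<in> unit_circle" for z
    unfolding f_def[abs_def] g_def[abs_def]
      id_minus_rot_lacunary_series[OF a that] id_minus_rot_lacunary_series[OF b that]
    by (simp add: a_def b_def mult.commute)
  have cont: "continuous_on unit_circle f" "continuous_on unit_circle g"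
    unfolding f_def g_def using a b by (intro continuous_on_lacunary_series; simp)+
  have no_h: False
    if meas: "h \<in> borel_measurable circle_measure"
      and eq: "AE z in circle_measure. id_minus_rot \<alpha> (id_minus_rot \<beta> h) z = id_minus_rot \<alpha> f z"
    for h :: "complex \<Rightarrow> complex"
  proof -
    let ?H = "\<lambda>t. h (e2pi t)"
    obtain E where E: "negligible E"
      "\<And>M N t. t \<notin> E \<Longrightarrow> second_diff ?H (of_nat M * \<alpha>) (of_nat N * \<beta>) t
        = (\<Sum>k. second_diff (\<lambda>t. e2pi (n k * t)) (of_nat M * \<alpha>) (of_nat N * \<beta>) t)"
      by (rule second_diff_series_off_negligible[OF a[unfolded a_def] b[unfolded b_def]
            eq[unfolded f_def[abs_def] b_def]]) blast
    \<comment> \<open>Radius 1/8: four values this close to \<open>w\<close> give a second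
      difference below 1/2, the lower bound to be contradicted.\<close>
    obtain w A where A: "A \<in> sets lborel" "A \<subseteq> {0..<1::real}" "emeasure lborel A \<noteq> 0"
      and w: "\<And>t. t \<in> A \<Longrightarrow> dist w (?H t) < 1/8"
      by (rule circle_measure_almost_constant_part[OF meas, of "1/8"]) (simp, blast)
    have "A \<subseteq> {0..1}" using A(2) by auto
    obtain \<delta> where "0 < \<delta>" and \<delta>: "\<And>x y. \<lbrakk>\<bar>x\<bar> < \<delta>; \<bar>y\<bar> < \<delta>\<rbrakk> \<Longrightarrow>
       \<not> negligible {t. t \<in> A \<and> t + x \<in> A \<and> t + y \<in> A \<and> t + x + y \<in> A}"
      by (rule positive_measure_parallelogram[OF A(1) \<open>A \<subseteq> {0..1}\<close> A(3)]) blast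
    obtain j :: nat where j: "1 / \<delta> < j" using reals_Archimedean2 by blast
    \<comment> \<open>The growth condition forces \<open>n j\<close> to be at least
      \<open>j\<close>, hence above 1/\<delta>. The fractional parts, at most 3/(4 n j), are then
      below \<delta>.\<close>
    have "(\<Sum>i<j. 1) \<le> (\<Sum>i<j. n i)"
      using n_pos by (intro sum_mono) (simp add: Suc_leI)
    then have "j \<le> n j" using growth[of j] by simp
    with j have "1 / \<delta> < n j" by linarith
    then have n\<delta>: "1 < n j * \<delta>" using \<open>0 < \<delta>\<close> by (simp add: field_simps)
    define x where "x = of_nat (K (n j)) * \<alpha>"
    define y where "y = of_nat (L (n j)) * \<beta>"
    have "n j * frac x < n j * \<delta>" "n j * frac y < n j * \<delta>"
      using K[OF n_pos[of j]] L[OF n_pos[of j]] n\<delta> unfolding x_def y_def by linarith+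
    then have frac_less: "\<bar>frac x\<bar> < \<delta>" "\<bar>frac y\<bar> < \<delta>"
      using n_pos[of j] by simp_all
    have "\<not> {t. t \<in> A \<and> t + frac x \<in> A \<and> t + frac y \<in> A \<and> t + frac x + frac y \<in> A} \<subseteq> E"
      using negligible_subset[OF E(1)] by (rule contrapos_nn[OF \<delta>[OF frac_less]])
    then obtain t where t: "t \<notin> E"
        and tA: "t \<in> A" "t + frac x \<in> A" "t + frac y \<in> A" "t + frac x + frac y \<in> A"
      by blast
    have triangle: "norm (p + q + r + s) \<le> norm p + norm q + norm r + norm s" for p q r s :: complex
      using norm_triangle_ineq[of "p + q + r" s] norm_triangle_ineq[of "p + q" r] norm_triangle_ineq[of p q]
      by linarith
    have "1/2 \<le> norm (\<Sum>k. second_diff (\<lambda>t. e2pi (n k * t)) x y t)"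
    proof (rule lacunary_second_diff_ge)
      show "norm (1 - e2pi (n k * x)) \<le> (1/2) ^ k / 16" if "j < k" for k
      proof -
        have "norm (1 - e2pi (n k * x)) \<le> K (n j) * norm (1 - e2pi (n k * \<alpha>))"
          using norm_one_minus_e2pi_of_nat_mult[of "K (n j)" "n k * \<alpha>"] by (simp add: x_def mult_ac)
        also have "\<dots> \<le> (1/2) ^ k / 16"
          using nK[OF that] by (simp add: power_one_over field_simps)
        finally show ?thesis .
      qed
    qed (use K[OF n_pos[of j]] L[OF n_pos[of j]] n_pos growth in \<open>auto simp: x_def y_def\<close>)
    \<comment> \<open>Off \<open>E\<close> the series equals the second difference of
      \<open>?H\<close> with the long steps; passing to fractional parts puts all four vertices into
      \<open>A\<close>.\<close>
    also have "\<dots> = norm (second_diff ?H (frac x) (frac y) t)"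
      using E(2)[OF t, of "K (n j)" "L (n j)"] second_diff_comp_e2pi_frac[of h x y t]
      unfolding x_def y_def by metis
    \<comment> \<open>The signs +, -, -, + add up to zero, so \<open>w\<close> cancels.\<close>
    also have "\<dots> = norm ((?H t - w) + (w - ?H (t + frac x)) + (w - ?H (t + frac y))
        + (?H (t + frac x + frac y) - w))"
      by (simp add: second_diff_def algebra_simps)
    also have "\<dots> \<le> dist w (?H t) + dist w (?H (t + frac x)) + dist w (?H (t + frac y))
        + dist w (?H (t + frac x + frac y))"
      unfolding dist_norm norm_minus_commute[of w "?H t"] norm_minus_commute[of w "?H (t + frac x + frac y)"]
      by (rule triangle)
    also have "\<dots> < 1/2"
      using w[OF tA(1)] w[OF tA(2)] w[OF tA(3)] w[OF tA(4)] by simp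
    finally show False by simp
  qed
  show ?thesis
  proof (rule exI[of _ f], rule exI[of _ g], intro conjI ballI notI)
    assume "\<exists>h. h \<in> borel_measurable circle_measure \<and>
      (AE z in circle_measure. id_minus_rot \<alpha> (id_minus_rot \<beta> h) z = id_minus_rot \<alpha> f z)"
    then show False by (elim exE conjE) (rule no_h)
  qed (fact cont f_g)+
qed

end
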